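(* Let $n \ge 1$ and $k \ge 1$ be integers and let $N = n + \frac12$. Then $$S_{2k} = \Delta_k \, N \begin{vmatrix} \binom{3}{2} & 0 & 0 & \cdots & 0 & (2N)^2 -1 \\ \binom{5}{2} & \binom{5}{4} & 0 & \cdots & 0 & (2N)^4 -1 \\ \binom{7}{2} & \binom{7}{4} & \binom{7}{6} & \cdots & 0 & (2N)^6 -1 \\ \vdots & \vdots & \vdots & \ddots & \vdots & \vdots \\ \binom{2k-1}{2} & \binom{2k-1}{4} & \binom{2k-1}{6} & \cdots & \binom{2k-1}{2k-2} & (2N)^{2k-2}-1 \\ \binom{2k+1}{2} & \binom{2k+1}{4} & \binom{2k+1}{6} & \cdots & \binom{2k+1}{2k-2} & (2N)^{2k} - 1 \end{vmatrix}, \qquad \Delta_k = \frac{(k+1)!}{(2k+2)!\, 2^{k-1}}.$$ That is, the determinant is that of the $k\times k$ matrix whose $(i,j)$ entry is $\binom{2i+1}{2j}$ for $1 \le i \le k$, $1 \le j \le k-1$ (which is $0$ when $j>i$), and whose $(i,k)$ entry is $(2N)^{2i}-1$ for $1 \le i \le k$; for $k=1$ this reads $S_2 = \Delta_1 N[(2N)^2-1]$. In particular, for each $k \ge 1$ this gives $S_{2k}$ as $N$ times an even polynomial in $N$ of degree $2k$ (with coefficients independent of $n$), i.e. as an odd polynomial in $N$ of degree $2k+1$.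
   Context: For integers $m \ge 0$ and $n \ge 1$, $S_m = 1^m + 2^m + \cdots + n^m$ denotes the sum of the $m$th powers of the first $n$ positive integers (the dependence on $n$ is suppressed in the notation). *)

theory Defs
  imports Complex_Main "HOL-Computational_Algebra.Polynomial" "Jordan_Normal_Form.Determinant"
begin

definition power_sum :: "nat \<Rightarrow> nat \<Rightarrow> nat" where
  "power_sum m n = (\<Sum>i = 1..n. i ^ m)"

definition Delta :: "nat \<Rightarrow> real" where
  "Delta k = fact (k + 1) / (fact (2 * k + 2) * 2 ^ (k - 1))"

text \<open>Matrix indices start at 0, so row \<open>i\<close> and column \<open>j\<close> of \<open>mat\<close> are row \<open>i + 1\<close>
  and column \<open>j + 1\<close> in the usual numbering.\<close>

definition power_sum_mat :: "nat \<Rightarrow> real \<Rightarrow> real mat" where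
  "power_sum_mat k N = mat k k (\<lambda>(i, j).
     if j + 1 < k then real ((2 * (i + 1) + 1) choose (2 * (j + 1)))
     else (2 * N) ^ (2 * (i + 1)) - 1)"

definition even_poly :: "real poly \<Rightarrow> bool" where
  "even_poly p \<longleftrightarrow> (\<forall>x. poly p (- x) = poly p x)"

definition odd_poly :: "real poly \<Rightarrow> bool" where
  "odd_poly p \<longleftrightarrow> (\<forall>x. poly p (- x) = - poly p x)"

end

theory Submission
  imports Defs
begin

text \<open>
  The matrix in question is a lower triangular matrix of binomial coefficients whose last column has
  been overwritten, which is the numerator of Cramer's rule. The linear system behind it comes from
  telescoping: for odd \<open>m = 2 i + 1\<close> the difference \<open>(x + 1) ^ m - (x - 1) ^ m\<close> contains
  only even powers of \<open>x\<close>, and putting \<open>x = 2 r\<close> and summing over \<open>r = 1, \<dots>, n\<close> turns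
  its left-hand side into \<open>(2 n + 1) ^ m - 1\<close> and its right-hand side into a combination of the
  even power sums (lemma \<open>even_power_sums_recurrence\<close>). In terms of \<open>N = n + 1 / 2\<close> these
  equations, for \<open>i = 1, \<dots>, k\<close>, form a triangular system for the unknowns
  \<open>4 ^ j S\<^sub>2\<^sub>j / N\<close> with right-hand sides \<open>(2 N) ^ (2 i) - 1\<close>. Solving for the last unknown gives the
  formula, because the determinant of the system is the product of the diagonal entries
  \<open>2 i + 1\<close>, and \<open>Delta k\<close> is exactly \<open>1 / (4 ^ k * 3 * 5 * \<dots> * (2 k + 1))\<close>.

  For the polynomial statement, the determinant is expanded along its last column, the only
  one that contains \<open>N\<close>. The result is a combination of even powers of \<open>N\<close>, and the top power
  \<open>N ^ (2 k)\<close> is multiplied by the determinant of the same triangular matrix of size \<open>k - 1\<close>,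
  which does not vanish.
\<close>

section \<open>A recurrence for even power sums\<close>

lemma odd_power_difference:
  fixes x :: "'a :: comm_ring_1"
  shows "(x + 1) ^ (2 * i + 1) - (x - 1) ^ (2 * i + 1)
       = 2 * (\<Sum>j\<le>i. of_nat ((2 * i + 1) choose (2 * j)) * x ^ (2 * j))"
proof -
  let ?m = "Suc (2 * i)"
  let ?f = "\<lambda>l. of_nat (?m choose l) * x ^ l * (1 - (- 1) ^ (?m - l))"
  have "(x + 1) ^ ?m - (x - 1) ^ ?m = (\<Sum>l\<le>?m. ?f l)"
    using binomial_ring[of x 1 ?m] binomial_ring[of x "- 1" ?m]
    by (simp add: sum_subtractf[symmetric] right_diff_distrib del: sum.atMost_Suc)
  also have "\<dots> = (\<Sum>j\<le>i. ?f (2 * j) + ?f (Suc (2 * j)))"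
    by (rule sum.in_pairs_0)
  also have "\<dots> = (\<Sum>j\<le>i. 2 * (of_nat (?m choose (2 * j)) * x ^ (2 * j)))"
    by (rule sum.cong) (auto simp: Suc_diff_le simp del: power_Suc binomial_Suc_Suc)
  finally show ?thesis
    by (simp add: sum_distrib_left del: power_Suc binomial_Suc_Suc)
qed

lemma telescoped_odd_powers:
  "(2 * real n + 1) ^ (2 * i + 1) - 1
     = 2 * (\<Sum>j\<le>i. real ((2 * i + 1) choose (2 * j)) * 4 ^ j * real (power_sum (2 * j) n))"
proof (induction n)
  case 0
  then show ?case by (simp add: power_sum_def)
next
  case (Suc n)
  define m where "m = 2 * i + 1"
  have step: "(2 * real (Suc n) + 1) ^ m - (2 * real n + 1) ^ m
      = 2 * (\<Sum>j\<le>i. real (m choose (2 * j)) * (2 * real (Suc n)) ^ (2 * j))"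
    using odd_power_difference[of "2 * real (Suc n)" i] unfolding m_def by (simp add: algebra_simps)
  have "(2 * real (Suc n) + 1) ^ m - 1 =
      2 * (\<Sum>j\<le>i. real (m choose (2 * j)) * 4 ^ j * real (power_sum (2 * j) n))
      + 2 * (\<Sum>j\<le>i. real (m choose (2 * j)) * (2 * real (Suc n)) ^ (2 * j))"
    using step Suc.IH unfolding m_def by linarith
  also have "\<dots> = 2 * (\<Sum>j\<le>i. real (m choose (2 * j)) * 4 ^ j * real (power_sum (2 * j) (Suc n)))"
    unfolding distrib_left[symmetric] sum.distrib[symmetric]
  proof (intro arg_cong[of _ _ "\<lambda>s. 2 * s"] sum.cong refl)
    fix j
    have "(2 * real (Suc n)) ^ (2 * j) = 4 ^ j * real (Suc n) ^ (2 * j)"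
      unfolding power_mult_distrib by (simp add: power_mult)
    then show "real (m choose (2 * j)) * 4 ^ j * real (power_sum (2 * j) n)
        + real (m choose (2 * j)) * (2 * real (Suc n)) ^ (2 * j)
        = real (m choose (2 * j)) * 4 ^ j * real (power_sum (2 * j) (Suc n))"
      by (simp add: power_sum_def distrib_left)
  qed
  finally show ?case unfolding m_def .
qed

text \<open>The term for \<open>j = 0\<close> of the telescoped identity is \<open>n = N - 1 / 2\<close>; moved to the other
  side, it cancels the constant and leaves a multiple of \<open>N\<close>.\<close>

lemma even_power_sums_recurrence:
  fixes n i :: nat
  defines "N \<equiv> real n + 1 / 2"
  shows "(\<Sum>j<i. real ((2 * i + 1) choose (2 * (j + 1))) * (4 ^ (j + 1) * real (power_sum (2 * (j + 1)) n)))
       = N * ((2 * N) ^ (2 * i) - 1)"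
proof -
  have "2 * real n + 1 = 2 * N" by (simp add: N_def)
  then have "(2 * N) ^ (2 * i + 1) - 1
      = 2 * (\<Sum>j<Suc i. real ((2 * i + 1) choose (2 * j)) * 4 ^ j * real (power_sum (2 * j) n))"
    using telescoped_odd_powers[of n i] by (simp only: lessThan_Suc_atMost)
  also have "\<dots> = 2 * (real n
      + (\<Sum>j<i. real ((2 * i + 1) choose (2 * (j + 1))) * (4 ^ (j + 1) * real (power_sum (2 * (j + 1)) n))))"
    unfolding sum.lessThan_Suc_shift
    by (simp add: power_sum_def mult.assoc)
  finally show ?thesis by (simp add: N_def algebra_simps)
qed

section \<open>Cramer's rule\<close>

definition odd_binomial_mat :: "nat \<Rightarrow> real mat" where
  "odd_binomial_mat k = mat k k (\<lambda>(i, j). real ((2 * (i + 1) + 1) choose (2 * (j + 1))))"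

lemma odd_binomial_mat_carrier [simp]: "odd_binomial_mat k \<in> carrier_mat k k"
  by (simp add: odd_binomial_mat_def)

lemma det_odd_binomial_mat: "det (odd_binomial_mat k) = (\<Prod>i<k. 2 * real i + 3)"
proof -
  have "det (odd_binomial_mat k) = prod_list (diag_mat (odd_binomial_mat k))"
    by (rule det_lower_triangular[of k]) (auto simp: odd_binomial_mat_def simp del: binomial_Suc_Suc)
  also have "\<dots> = (\<Prod>i<k. real ((2 * (i + 1) + 1) choose (2 * (i + 1))))"
    unfolding prod_list_diag_prod
    by (rule prod.cong) (auto simp: odd_binomial_mat_def simp del: binomial_Suc_Suc)
  also have "\<dots> = (\<Prod>i<k. 2 * real i + 3)"
    by (rule prod.cong) (auto simp: binomial_symmetric[of "2 * (_ + 1)" "2 * (_ + 1) + 1"] simp del: binomial_Suc_Suc)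
  finally show ?thesis .
qed

lemma Delta_eq:
  assumes "k \<ge> 1"
  shows "Delta k * (4 ^ k * det (odd_binomial_mat k)) = 1"
proof -
  have "fact (k + 1) * 4 ^ k * (\<Prod>i<k. 2 * real i + 3) * 2 = fact (2 * k + 2) * 2 ^ k"
  proof (induction k)
    case (Suc k)
    have "fact (Suc k + 1) * 4 ^ Suc k * (\<Prod>i<Suc k. 2 * real i + 3) * 2
        = (fact (k + 1) * 4 ^ k * (\<Prod>i<k. 2 * real i + 3) * 2) * ((real k + 2) * 4 * (2 * real k + 3))"
      by (simp add: algebra_simps)
    also have "\<dots> = fact (2 * k + 2) * 2 ^ k * ((real k + 2) * 4 * (2 * real k + 3))"
      by (simp only: Suc.IH)
    also have "\<dots> = fact (2 * k + 2) * (2 * real k + 3) * (2 * real k + 4) * 2 ^ Suc k"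
      by (simp add: algebra_simps)
    also have "fact (2 * k + 2) * (2 * real k + 3) * (2 * real k + 4) = fact (2 * Suc k + 2)"
      by (simp add: algebra_simps)
    finally show ?case .
  qed simp
  moreover have "(2 :: real) ^ k = 2 * 2 ^ (k - 1)"
    using assms by (cases k) auto
  ultimately show ?thesis
    by (simp add: Delta_def det_odd_binomial_mat field_simps del: fact_Suc)
qed

lemma power_sum_mat_eq_replace_col:
  assumes "k \<ge> 1"
  shows "power_sum_mat k N
       = replace_col (odd_binomial_mat k) (vec k (\<lambda>i. (2 * N) ^ (2 * (i + 1)) - 1)) (k - 1)"
  using assms
  by (intro eq_matI) (auto simp: power_sum_mat_def replace_col_def odd_binomial_mat_def
        simp del: binomial_Suc_Suc)

lemma power_sum_eq_det:
  fixes n k :: nat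
  assumes "k \<ge> 1"
  defines "N \<equiv> real n + 1 / 2"
  shows "real (power_sum (2 * k) n) = Delta k * N * det (power_sum_mat k N)"
proof -
  let ?A = "odd_binomial_mat k"
  have N: "N > 0" by (simp add: N_def)
  \<comment> \<open>Dividing the unknowns by \<open>N\<close> makes the right-hand side equal to the last column itself.\<close>
  define s where "s j = 4 ^ (j + 1) * real (power_sum (2 * (j + 1)) n)" for j
  define x where "x = vec k (\<lambda>j. s j / N)"
  have x: "x \<in> carrier_vec k" by (simp add: x_def)
  have "?A *\<^sub>v x = vec k (\<lambda>i. (2 * N) ^ (2 * (i + 1)) - 1)"
  proof (rule eq_vecI)
    fix i assume "i < dim_vec (vec k (\<lambda>i. (2 * N) ^ (2 * (i + 1)) - 1))"
    then have i: "i < k" by simp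
    have "(?A *\<^sub>v x) $ i = (\<Sum>j<k. real ((2 * (i + 1) + 1) choose (2 * (j + 1))) * s j / N)"
      using i by (simp add: x_def odd_binomial_mat_def scalar_prod_def lessThan_atLeast0
          del: binomial_Suc_Suc)
    also have "\<dots> = (\<Sum>j<i + 1. real ((2 * (i + 1) + 1) choose (2 * (j + 1))) * s j / N)"
      using i by (intro sum.mono_neutral_right) (auto simp del: binomial_Suc_Suc)
    also have "\<dots> = (2 * N) ^ (2 * (i + 1)) - 1"
      unfolding sum_divide_distrib[symmetric] s_def
      using even_power_sums_recurrence[where n = n and i = "i + 1", folded N_def] N
      by (simp only:) simp
    finally show "(?A *\<^sub>v x) $ i = vec k (\<lambda>i. (2 * N) ^ (2 * (i + 1)) - 1) $ i"
      using i by simp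
  qed (simp add: odd_binomial_mat_def)
  then have "det (power_sum_mat k N) = x $ (k - 1) * det ?A"
    using cramer_lemma_mat[OF odd_binomial_mat_carrier x, of "k - 1"] assms(1)
    by (simp add: power_sum_mat_eq_replace_col)
  also have "x $ (k - 1) = 4 ^ k * real (power_sum (2 * k) n) / N"
    using assms(1) by (cases k) (simp_all add: x_def s_def)
  finally have "Delta k * N * det (power_sum_mat k N)
      = (Delta k * (4 ^ k * det ?A)) * real (power_sum (2 * k) n)"
    using N by simp
  then show ?thesis
    using Delta_eq[OF assms(1)] by simp
qed

section \<open>The determinant as an even polynomial\<close>

text \<open>Deleting the last column removes every entry that depends on \<open>N\<close>.\<close>

lemma mat_delete_power_sum_mat:
  "mat_delete (power_sum_mat k x) i (k - 1) = mat_delete (odd_binomial_mat k) i (k - 1)"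
  by (rule eq_matI)
     (auto simp: mat_delete_def power_sum_mat_def odd_binomial_mat_def simp del: binomial_Suc_Suc)

lemma mat_delete_odd_binomial_mat:
  "mat_delete (odd_binomial_mat k) (k - 1) (k - 1) = odd_binomial_mat (k - 1)"
  by (rule eq_matI)
     (auto simp: mat_delete_def odd_binomial_mat_def simp del: binomial_Suc_Suc)

lemma det_power_sum_mat_expansion:
  assumes "k \<ge> 1"
  shows "det (power_sum_mat k x)
       = (\<Sum>i<k. ((2 * x) ^ (2 * (i + 1)) - 1) * cofactor (odd_binomial_mat k) i (k - 1))"
proof -
  have "det (power_sum_mat k x)
      = (\<Sum>i<k. power_sum_mat k x $$ (i, k - 1) * cofactor (power_sum_mat k x) i (k - 1))"
    by (rule laplace_expansion_column) (use assms in \<open>auto simp: power_sum_mat_def\<close>)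
  also have "\<dots> = (\<Sum>i<k. ((2 * x) ^ (2 * (i + 1)) - 1) * cofactor (odd_binomial_mat k) i (k - 1))"
  proof (intro sum.cong refl arg_cong2[of _ _ _ _ "(*)"])
    fix i assume "i \<in> {..<k}"
    then show "power_sum_mat k x $$ (i, k - 1) = (2 * x) ^ (2 * (i + 1)) - 1"
      using assms by (auto simp: power_sum_mat_def)
    show "cofactor (power_sum_mat k x) i (k - 1) = cofactor (odd_binomial_mat k) i (k - 1)"
      unfolding cofactor_def mat_delete_power_sum_mat ..
  qed
  finally show ?thesis .
qed

lemma det_power_sum_mat_poly:
  assumes "k \<ge> 1"
  obtains p where "\<And>x. poly p x = det (power_sum_mat k x)" "even_poly p" "degree p = 2 * k"
proof -
  define c where "c i = cofactor (odd_binomial_mat k) i (k - 1)" for i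
  define p where "p = (\<Sum>i<k. smult (c i) (monom (4 ^ (i + 1)) (2 * (i + 1)) - 1))"
  have p: "poly p x = det (power_sum_mat k x)" for x
    unfolding p_def det_power_sum_mat_expansion[OF assms] poly_sum
    by (rule sum.cong) (simp_all add: c_def poly_monom power_mult power_mult_distrib)
  have "even_poly p"
    unfolding even_poly_def p det_power_sum_mat_expansion[OF assms] by (simp add: power_mult)
  moreover have "degree p = 2 * k"
  proof (rule antisym)
    show "degree p \<le> 2 * k"
      unfolding p_def
      by (intro degree_sum_le order.trans[OF degree_smult_le] degree_diff_le
            order.trans[OF degree_monom_le]) auto
    have "coeff p (2 * k) = (\<Sum>i<k. if i = k - 1 then c i * 4 ^ k else 0)"
      unfolding p_def coeff_sum using assms by (cases k) (auto intro!: sum.cong)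
    also have "\<dots> = c (k - 1) * 4 ^ k"
      using assms by simp
    also have "c (k - 1) = (\<Prod>i<k - 1. 2 * real i + 3)"
      by (simp add: c_def cofactor_def mat_delete_odd_binomial_mat[simplified] det_odd_binomial_mat)
    finally have "coeff p (2 * k) > 0"
      by (simp add: prod_pos add_nonneg_pos)
    then show "2 * k \<le> degree p"
      by (intro le_degree) simp
  qed
  ultimately show ?thesis
    using that p by blast
qed

theorem mainTheorem2:
  fixes k :: nat
  assumes "k \<ge> 1"
  shows "(\<forall>n::nat. n \<ge> 1 \<longrightarrow>
            (let N = real n + 1 / 2 in
               real (power_sum (2 * k) n) = Delta k * N * det (power_sum_mat k N)))
       \<and> (\<exists>p q :: real poly.
            (\<forall>x. poly p x = Delta k * det (power_sum_mat k x))
          \<and> even_poly p \<and> degree p = 2 * k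
          \<and> q = [:0, 1:] * p \<and> odd_poly q \<and> degree q = 2 * k + 1
          \<and> (\<forall>n::nat. n \<ge> 1 \<longrightarrow>
               (let N = real n + 1 / 2 in
                  real (power_sum (2 * k) n) = N * poly p N
                \<and> real (power_sum (2 * k) n) = poly q N)))"
proof -
  obtain d where d: "\<And>x. poly d x = det (power_sum_mat k x)" "even_poly d" "degree d = 2 * k"
    using det_power_sum_mat_poly[OF assms] by blast
  define p where "p = smult (Delta k) d"
  define q where "q = [:0, 1:] * p"
  have "Delta k \<noteq> 0" by (simp add: Delta_def)
  then have deg: "degree p = 2 * k" by (simp add: p_def d)
  then have "p \<noteq> 0" using assms by auto
  then have "degree q = 2 * k + 1"
    unfolding q_def by (subst degree_mult_eq) (auto simp: deg)
  moreover have "even_poly p" using d(2) by (simp add: even_poly_def p_def)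
  moreover from this have "odd_poly q" by (simp add: even_poly_def odd_poly_def q_def)
  moreover have "\<forall>x. poly p x = Delta k * det (power_sum_mat k x)"
    by (simp add: p_def d)
  moreover have "real (power_sum (2 * k) n)
      = Delta k * (real n + 1 / 2) * det (power_sum_mat k (real n + 1 / 2))" for n
    using power_sum_eq_det[OF assms] .
  ultimately show ?thesis
    using deg q_def by (intro conjI exI[of _ p] exI[of _ q]) (simp_all add: Let_def)
qed

end
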